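(* Let $\mathcal{Z}\subset\mathbb{R}^d$ be nonempty, closed and convex, and let $F:\mathcal{Z}\to\mathbb{R}^d$ be a monotone operator that is locally Lipschitz continuous on $\mathcal{Z}$. Assume the variational inequality $\langle F(z_* ),z-z_*\rangle\ge 0$ for all $z\in\mathcal{Z}$ has a solution $z_*\in\mathcal{Z}$. Let $z_0\in\mathcal{Z}$, $\eta_0>0$, $\theta\in(0,1)$, $\rho\in(0,1)$, and run the PF-NE-EG algorithm with standard backtracking line search described in the context. Then the total number of backtracking reductions (replacements of $\eta$ by $\rho\eta$ in step (1)), summed over all iterations, is finite. In particular, there exists $\bar\eta>0$ such that $\eta_t\ge\bar\eta$ for all $t\in\mathbb{N}$ (for which $\eta_t$ is defined).
   Context: $F$ is monotone if $\langle F(z)-F(w),z-w\rangle\ge0$ for all $z,w\in\mathcal{Z}$. $F$ is locally Lipschitz on $\mathcal{Z}$ if for every $z\in\mathcal{Z}$ there are $L(z)>0$ and a (relative) neighborhood $N(z)\subset\mathcal{Z}$ of $z$ with $\|F(z')-F(z'')\|_2\le L(z)\|z'-z''\|_2$ for all $z',z''\in N(z)$. $\mathrm{Proj}_{\mathcal{Z}}$ is the Euclidean projection onto $\mathcal{Z}$. Extragradient update with stepsize $\eta_t>0$: $w_t=\mathrm{Proj}_{\mathcal{Z}}(z_t-\eta_tF(z_t))$, $z_{t+1}=\mathrm{Proj}_{\mathcal{Z}}(z_t-\eta_tF(w_t))$. PF-NE-EG algorithm with standard backtracking line search: compute $w_0,z_1$ by the extragradient update from $z_0$ with stepsize $\eta_0$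 (stop and return $z_0$ if $w_0=z_0$). For $t=1,2,\dots$: (1) For $\eta>0$ let $w_t(\eta)=\mathrm{Proj}_{\mathcal{Z}}(z_t-\eta F(z_t))$ and $z_{t+1}(\eta)=\mathrm{Proj}_{\mathcal{Z}}(z_t-\eta F(w_t(\eta)))$. Starting with $\eta=\eta_{t-1}$, repeatedly replace $\eta$ by $\rho\eta$ until both $\eta\,\|F(w_t(\eta))-F(z_t)\|_2/\|w_t(\eta)-z_t\|_2\le\theta$ and, if $w_t(\eta)\ne z_{t+1}(\eta)$, $\eta\,\|F(w_t(\eta))-F(z_{t+1}(\eta))\|_2/\|w_t(\eta)-z_{t+1}(\eta)\|_2\le1$ hold; if $w_t(\eta)=z_t$ is encountered, stop and return $z_t$ (which is then a solution of the variational inequality). Set $\eta_t=\eta$. (2) Compute $w_t,z_{t+1}$ by the extragradient update with stepsize $\eta_t$. *)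

theory Defs
  imports "HOL-Analysis.Analysis" "HOL-Library.Extended_Nat"
begin

text \<open>An operator on \<^term>\<open>Z\<close> is represented by a total function \<^term>\<open>F\<close>; every
  definition below uses its values on \<^term>\<open>Z\<close> only (given a start point in \<^term>\<open>Z\<close>).\<close>

definition monotone_operator_on :: "'a::euclidean_space set \<Rightarrow> ('a \<Rightarrow> 'a) \<Rightarrow> bool" where
  "monotone_operator_on Z F \<longleftrightarrow> (\<forall>z\<in>Z. \<forall>w\<in>Z. (F z - F w) \<bullet> (z - w) \<ge> 0)"

definition locally_lipschitz_on :: "'a::euclidean_space set \<Rightarrow> ('a \<Rightarrow> 'a) \<Rightarrow> bool" where
  "locally_lipschitz_on Z F \<longleftrightarrow>
     (\<forall>z\<in>Z. \<exists>L>0. \<exists>N. openin (top_of_set Z) N \<and> z \<in> N \<and> L-lipschitz_on N F)"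

definition vi_solution :: "'a::euclidean_space set \<Rightarrow> ('a \<Rightarrow> 'a) \<Rightarrow> 'a \<Rightarrow> bool" where
  "vi_solution Z F zs \<longleftrightarrow> zs \<in> Z \<and> (\<forall>z\<in>Z. F zs \<bullet> (z - zs) \<ge> 0)"

definition eg_w :: "'a::euclidean_space set \<Rightarrow> ('a \<Rightarrow> 'a) \<Rightarrow> 'a \<Rightarrow> real \<Rightarrow> 'a" where
  "eg_w Z F z \<eta> = closest_point Z (z - \<eta> *\<^sub>R F z)"

definition eg_next :: "'a::euclidean_space set \<Rightarrow> ('a \<Rightarrow> 'a) \<Rightarrow> 'a \<Rightarrow> real \<Rightarrow> 'a" where
  "eg_next Z F z \<eta> = closest_point Z (z - \<eta> *\<^sub>R F (eg_w Z F z \<eta>))"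

text \<open>The first quotient below is only consulted when \<^term>\<open>eg_w Z F z \<eta> \<noteq> z\<close>.\<close>

definition step_accepted ::
  "'a::euclidean_space set \<Rightarrow> ('a \<Rightarrow> 'a) \<Rightarrow> real \<Rightarrow> 'a \<Rightarrow> real \<Rightarrow> bool" where
  "step_accepted Z F \<theta> z \<eta> \<longleftrightarrow>
     (let w = eg_w Z F z \<eta>; z' = eg_next Z F z \<eta> in
        \<eta> * norm (F w - F z) / norm (w - z) \<le> \<theta> \<and>
        (w \<noteq> z' \<longrightarrow> \<eta> * norm (F w - F z') / norm (w - z') \<le> 1))"

text \<open>A line search at \<^term>\<open>z\<close> started with \<^term>\<open>\<eta>\<close> tries the stepsizes \<^term>\<open>\<rho> ^ j * \<eta>\<close> for
  \<open>j = 0, 1, \<dots>\<close> and is left at the first one at which the algorithm either stops or accepts;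
  this index \<open>j\<close> is the number of reductions. The number is infinite if the search never ends.\<close>

definition search_ends ::
  "'a::euclidean_space set \<Rightarrow> ('a \<Rightarrow> 'a) \<Rightarrow> real \<Rightarrow> 'a \<Rightarrow> real \<Rightarrow> bool" where
  "search_ends Z F \<theta> z \<eta> \<longleftrightarrow> eg_w Z F z \<eta> = z \<or> step_accepted Z F \<theta> z \<eta>"

definition num_reductions ::
  "'a::euclidean_space set \<Rightarrow> ('a \<Rightarrow> 'a) \<Rightarrow> real \<Rightarrow> real \<Rightarrow> 'a \<Rightarrow> real \<Rightarrow> enat" where
  "num_reductions Z F \<theta> \<rho> z \<eta> =
     (if \<exists>j. search_ends Z F \<theta> z (\<rho> ^ j * \<eta>)
      then enat (LEAST j. search_ends Z F \<theta> z (\<rho> ^ j * \<eta>)) else \<infinity>)"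

text \<open>The accepted stepsize; \<^term>\<open>None\<close> if the algorithm stops at \<^term>\<open>z\<close> or the search never ends.\<close>

definition line_search ::
  "'a::euclidean_space set \<Rightarrow> ('a \<Rightarrow> 'a) \<Rightarrow> real \<Rightarrow> real \<Rightarrow> 'a \<Rightarrow> real \<Rightarrow> real option" where
  "line_search Z F \<theta> \<rho> z \<eta> =
     (case num_reductions Z F \<theta> \<rho> z \<eta> of
        enat j \<Rightarrow> (if eg_w Z F z (\<rho> ^ j * \<eta>) = z then None else Some (\<rho> ^ j * \<eta>))
      | \<infinity> \<Rightarrow> None)"

text \<open>State after iteration \<open>t\<close>: the pair \<open>(z\<^sub>t\<^sub>+\<^sub>1, \<eta>\<^sub>t)\<close>, or \<^term>\<open>None\<close> if
  iteration \<open>t\<close> is not reached or not completed. Iteration \<open>0\<close> uses \<open>\<eta>\<^sub>0\<close> without line search.\<close>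

primrec pf_ne_eg ::
  "'a::euclidean_space set \<Rightarrow> ('a \<Rightarrow> 'a) \<Rightarrow> real \<Rightarrow> real \<Rightarrow> 'a \<Rightarrow> real \<Rightarrow> nat \<Rightarrow> ('a \<times> real) option" where
  "pf_ne_eg Z F \<theta> \<rho> z0 \<eta>0 0 =
     (if eg_w Z F z0 \<eta>0 = z0 then None else Some (eg_next Z F z0 \<eta>0, \<eta>0))"
| "pf_ne_eg Z F \<theta> \<rho> z0 \<eta>0 (Suc t) =
     (case pf_ne_eg Z F \<theta> \<rho> z0 \<eta>0 t of
        None \<Rightarrow> None
      | Some (z, \<eta>) \<Rightarrow>
          map_option (\<lambda>\<eta>'. (eg_next Z F z \<eta>', \<eta>')) (line_search Z F \<theta> \<rho> z \<eta>))"

text \<open>\<open>\<eta>\<^sub>t\<close>, where defined. The input \<open>\<eta>\<^sub>0\<close> is defined even if the algorithm stops at once.\<close>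

definition stepsize ::
  "'a::euclidean_space set \<Rightarrow> ('a \<Rightarrow> 'a) \<Rightarrow> real \<Rightarrow> real \<Rightarrow> 'a \<Rightarrow> real \<Rightarrow> nat \<Rightarrow> real option" where
  "stepsize Z F \<theta> \<rho> z0 \<eta>0 t =
     (if t = 0 then Some \<eta>0 else map_option snd (pf_ne_eg Z F \<theta> \<rho> z0 \<eta>0 t))"

text \<open>Number of backtracking reductions in iteration \<open>t\<close>; \<open>0\<close> for iterations that are not reached.\<close>

definition reductions_at ::
  "'a::euclidean_space set \<Rightarrow> ('a \<Rightarrow> 'a) \<Rightarrow> real \<Rightarrow> real \<Rightarrow> 'a \<Rightarrow> real \<Rightarrow> nat \<Rightarrow> enat" where
  "reductions_at Z F \<theta> \<rho> z0 \<eta>0 t =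
     (case t of
        0 \<Rightarrow> 0
      | Suc s \<Rightarrow> (case pf_ne_eg Z F \<theta> \<rho> z0 \<eta>0 s of
            None \<Rightarrow> 0
          | Some (z, \<eta>) \<Rightarrow> num_reductions Z F \<theta> \<rho> z \<eta>))"

end

theory Submission imports Defs
begin

text \<open>The first acceptance test makes every accepted extragradient step nonexpansive towards a
  solution, so all iterates after the first stay in a fixed bounded set. Trial points with
  stepsize at most \<open>1\<close> then stay in a fixed compact subset of \<open>Z\<close>, on which \<open>F\<close> is Lipschitz.
  Hence every search tried below some fixed threshold \<open>c\<close> ends, and since the search never
  increases the stepsize, at most \<open>N\<close> reductions occur altogether, where \<open>\<rho>\<^sup>N \<eta>\<^sub>0 \<le> c\<close>.\<close>

text \<open>Viewing \<open>F\<close> as a family that is constant in a dummy time ranging over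
  \<open>{0}\<close> makes the hypothesis an instance of \<open>local_lipschitz\<close>, for which
  compactness yields one constant on all of \<open>K\<close>.\<close>

lemma locally_lipschitz_on_compact:
  fixes F :: "'a::euclidean_space \<Rightarrow> 'a"
  assumes F: "locally_lipschitz_on Z F" and K: "compact K" "K \<subseteq> Z"
  shows "\<exists>L. L-lipschitz_on K F"
proof -
  have "local_lipschitz {0::real} K (\<lambda>_. F)"
  proof (rule local_lipschitzI)
    fix x assume "x \<in> K"
    then have "x \<in> Z" using K by blast
    then obtain L N where N: "openin (top_of_set Z) N" "x \<in> N" "L-lipschitz_on N F"
      using F unfolding locally_lipschitz_on_def by blast
    then obtain u where u: "u > 0" "cball x u \<inter> Z \<subseteq> N"
      unfolding openin_contains_cball by blast
    then have "L-lipschitz_on (cball x u \<inter> K) F"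
      using lipschitz_on_subset[OF N(3)] K(2) by blast
    then show "\<exists>u>0. \<exists>L. \<forall>t\<in>cball t u \<inter> {0::real}. L-lipschitz_on (cball x u \<inter> K) F" for t
      using u(1) by blast
  qed
  then obtain L where "\<And>t. t \<in> {0::real} \<Longrightarrow> L-lipschitz_on K F"
    by (rule local_lipschitz_compact_implies_lipschitz[OF _ K(1)]) auto
  then show ?thesis by blast
qed

text \<open>Projection is nonexpansive and fixes \<open>z\<close>. This bounds how far a trial point
  can lie from the current iterate.\<close>

lemma closest_point_step_le:
  fixes z :: "'a::euclidean_space"
  assumes "convex Z" "closed Z" "z \<in> Z"
  shows "norm (closest_point Z (z - v) - z) \<le> norm v"
proof -
  have "dist (closest_point Z (z - v)) (closest_point Z z) \<le> dist (z - v) z"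
    using assms by (intro closest_point_lipschitz) auto
  then show ?thesis using assms by (simp add: closest_point_self dist_norm)
qed

lemma eg_in_set:
  assumes "closed Z" "Z \<noteq> {}"
  shows "eg_w Z F z \<eta> \<in> Z" "eg_next Z F z \<eta> \<in> Z"
  using assms by (auto simp: eg_w_def eg_next_def closest_point_in_set)

text \<open>The classical extragradient estimate: the two projection inequalities and monotonicity
  at the solution leave one error term, \<eta> times the inner product of \<open>F w - F z\<close>
  with \<open>w - y\<close>. The first acceptance test lets the squares of \<open>w - z\<close> and
  \<open>w - y\<close> absorb it.\<close>

lemma eg_next_nonexpansive:
  fixes z :: "'a::euclidean_space"
  assumes Z: "closed Z" "convex Z" and mono: "monotone_operator_on Z F"
    and sol: "vi_solution Z F zs" and z: "z \<in> Z" and \<eta>: "\<eta> > 0" and \<theta>: "\<theta> \<le> 1"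
    and ne: "eg_w Z F z \<eta> \<noteq> z" and acc: "step_accepted Z F \<theta> z \<eta>"
  shows "norm (eg_next Z F z \<eta> - zs) \<le> norm (z - zs)"
proof -
  define w where "w = eg_w Z F z \<eta>"
  define y where "y = eg_next Z F z \<eta>"
  have zs: "zs \<in> Z" using sol by (simp add: vi_solution_def)
  have w: "w \<in> Z" and y: "y \<in> Z" using eg_in_set[OF Z(1)] z unfolding w_def y_def by blast+
  \<comment> \<open>The obtuse-angle property of the projection: the one defining \<open>w\<close>
    is tested at \<open>y\<close>, the one defining \<open>y\<close> at the solution.\<close>
  have 1: "((z - \<eta> *\<^sub>R F z) - w) \<bullet> (y - w) \<le> 0"
    unfolding w_def eg_w_def by (rule closest_point_dot[OF Z(2,1) y])
  have 2: "((z - \<eta> *\<^sub>R F w) - y) \<bullet> (zs - y) \<le> 0"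
    using closest_point_dot[OF Z(2,1) zs, of "z - \<eta> *\<^sub>R F w"]
    by (simp add: y_def eg_next_def w_def)
  have "(F w - F zs) \<bullet> (w - zs) \<ge> 0" "F zs \<bullet> (w - zs) \<ge> 0"
    using mono sol w zs by (auto simp: monotone_operator_on_def vi_solution_def)
  then have "F w \<bullet> (w - zs) \<ge> 0" by (simp add: inner_diff_left)
  then have 3: "\<eta> * (F w \<bullet> (w - zs)) \<ge> 0" using \<eta> by simp
  have "\<eta> * norm (F w - F z) \<le> \<theta> * norm (w - z)"
    using acc ne by (simp add: step_accepted_def Let_def w_def divide_simps)
  also have "\<dots> \<le> norm (w - z)" using \<theta> mult_right_mono[of \<theta> 1 "norm (w - z)"] by simp
  finally have "norm (\<eta> *\<^sub>R (F w - F z)) * norm (w - y) \<le> norm (w - z) * norm (w - y)"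
    using \<eta> by (intro mult_right_mono) auto
  then have 4: "(\<eta> *\<^sub>R (F w - F z)) \<bullet> (w - y) \<le> norm (w - z) * norm (w - y)"
    using norm_cauchy_schwarz order_trans by blast
  have 5: "2 * (norm (w - z) * norm (w - y)) \<le> (w - z) \<bullet> (w - z) + (w - y) \<bullet> (w - y)"
    using sum_squares_bound[of "norm (w - z)" "norm (w - y)"]
    by (simp add: power2_norm_eq_inner)
  \<comment> \<open>Twice each of 1 to 4 plus 5, after expanding the squares through
    \<open>z - y\<close> and \<open>z - w\<close>.\<close>
  have "(y - zs) \<bullet> (y - zs) \<le> (z - zs) \<bullet> (z - zs)"
    using 1 2 3 4 5 by (simp add: inner_simps inner_commute algebra_simps)
  then show ?thesis by (simp add: norm_le y_def)
qed

text \<open>For stepsizes at most 1 a trial point moves by at most the norm of the operator value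
  used. So a bound on \<open>F\<close> near \<open>a\<close> confines \<open>w\<close>, and a bound
  on the larger ball containing \<open>w\<close> confines \<open>y\<close>. On a compact set holding
  \<open>z\<close>, \<open>w\<close> and \<open>y\<close>, both tests follow from one Lipschitz
  constant.\<close>

lemma search_ends_below_threshold:
  fixes Z :: "'a::euclidean_space set"
  assumes Z: "closed Z" "convex Z" "Z \<noteq> {}" and F: "locally_lipschitz_on Z F"
    and \<theta>: "0 < \<theta>" "\<theta> \<le> 1"
  obtains c where "c > 0"
    "\<And>z \<eta>. z \<in> Z \<Longrightarrow> norm (z - a) \<le> R \<Longrightarrow> 0 < \<eta> \<Longrightarrow> \<eta> \<le> c \<Longrightarrow> search_ends Z F \<theta> z \<eta>"
proof -
  have comp: "compact (Z \<inter> cball a r)" for r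
    using Z by (simp add: closed_Int_compact)
  \<comment> \<open>Nonnegative bounds make the radius of \<open>K\<close> below dominate the
    smaller radii; hence the witness \<open>max 0 M\<close>.\<close>
  have bnd: "\<exists>M\<ge>0. \<forall>z\<in>Z. norm (z - a) \<le> r \<longrightarrow> norm (F z) \<le> M" for r
  proof -
    obtain L where "L-lipschitz_on (Z \<inter> cball a r) F"
      using locally_lipschitz_on_compact[OF F comp] by blast
    then have "compact (F ` (Z \<inter> cball a r))"
      by (intro compact_continuous_image lipschitz_on_continuous_on comp)
    then obtain M where "\<forall>y\<in>F ` (Z \<inter> cball a r). norm y \<le> M"
      using compact_imp_bounded bounded_iff by metis
    then show ?thesis
      by (intro exI[of _ "max 0 M"]) (auto simp: dist_norm norm_minus_commute le_max_iff_disj)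
  qed
  obtain M1 where M1: "M1 \<ge> 0" "\<And>z. z \<in> Z \<Longrightarrow> norm (z - a) \<le> R \<Longrightarrow> norm (F z) \<le> M1"
    using bnd[of R] by blast
  obtain M2 where M2: "M2 \<ge> 0" "\<And>z. z \<in> Z \<Longrightarrow> norm (z - a) \<le> R + M1 \<Longrightarrow> norm (F z) \<le> M2"
    using bnd[of "R + M1"] by blast
  \<comment> \<open>This ball contains \<open>z\<close>, \<open>w\<close> and \<open>y\<close>,
    whose distances from \<open>a\<close> are at most \<open>R\<close>, \<open>R + M1\<close> and
    \<open>R + M2\<close>.\<close>
  define K where "K = Z \<inter> cball a (R + M1 + M2)"
  obtain L where "L-lipschitz_on K F"
    using locally_lipschitz_on_compact[OF F comp] unfolding K_def by blast
  then have lip: "norm (F x - F y) \<le> max L 1 * norm (x - y)" if "x \<in> K" "y \<in> K" for x y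
    using that mult_right_mono[of L "max L 1" "norm (x - y)"]
    by (fastforce dest: lipschitz_onD simp: dist_norm)
  \<comment> \<open>The cap 1 controls the displacements, the quotient gives the tests. Since
    \<open>L\<close> may be 0, \<open>max L 1\<close> keeps the divisor positive.\<close>
  define c where "c = min 1 (\<theta> / max L 1)"
  show thesis
  proof
    show "c > 0" using \<theta> by (simp add: c_def)
  next
    fix z \<eta> assume z: "z \<in> Z" "norm (z - a) \<le> R" and \<eta>: "0 < \<eta>" "\<eta> \<le> c"
    have \<eta>1: "\<eta> \<le> 1" and \<eta>L: "\<eta> * max L 1 \<le> \<theta>"
      using \<eta> by (auto simp: c_def pos_le_divide_eq)
    have shrink: "norm (\<eta> *\<^sub>R v) \<le> norm v" for v :: 'a
      using \<eta> \<eta>1 mult_right_mono[of \<eta> 1 "norm v"] by simp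
    define w where "w = eg_w Z F z \<eta>"
    define y where "y = eg_next Z F z \<eta>"
    have w: "w \<in> Z" and y: "y \<in> Z" using eg_in_set[OF Z(1,3)] unfolding w_def y_def by blast+
    have "norm (w - z) \<le> M1"
      using closest_point_step_le[OF Z(2,1) z(1)] shrink M1(2)[OF z]
      unfolding w_def eg_w_def by (meson order_trans)
    then have wa: "norm (w - a) \<le> R + M1" using z(2) norm_triangle_le[of "w - z" "z - a"] by simp
    have "norm (y - z) \<le> M2"
      using closest_point_step_le[OF Z(2,1) z(1)] shrink M2(2)[OF w wa]
      unfolding w_def y_def eg_next_def by (meson order_trans)
    then have ya: "norm (y - a) \<le> R + M2" using z(2) norm_triangle_le[of "y - z" "z - a"] by simp
    have K: "z \<in> K" "w \<in> K" "y \<in> K"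
      using z w y wa ya M1(1) M2(1) by (auto simp: K_def dist_norm norm_minus_commute)
    \<comment> \<open>The case \<open>u = z\<close> is the first test; \<open>u = y\<close> gives
      the second because \<theta> is at most 1.\<close>
    have lipK: "\<eta> * norm (F w - F u) \<le> \<theta> * norm (w - u)" if "u = z \<or> u = y" for u
    proof -
      have "u \<in> K" using that K by blast
      then have "\<eta> * norm (F w - F u) \<le> \<eta> * (max L 1 * norm (w - u))"
        using lip K(2) \<eta>(1) by (intro mult_left_mono) auto
      also have "\<dots> \<le> \<theta> * norm (w - u)"
        using mult_right_mono[OF \<eta>L, of "norm (w - u)"] by (simp add: mult.assoc)
      finally show ?thesis .
    qed
    have "\<eta> * norm (F w - F z) \<le> \<theta> * norm (w - z)"
      and "\<eta> * norm (F w - F y) \<le> 1 * norm (w - y)"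
      using lipK mult_right_mono[OF \<theta>(2), of "norm (w - y)"]
      by (blast intro: order_trans norm_ge_zero)+
    \<comment> \<open>If \<open>w = z\<close> the search ends by stopping; otherwise the
      denominators are positive and can be cleared.\<close>
    then show "search_ends Z F \<theta> z \<eta>"
      unfolding search_ends_def step_accepted_def Let_def w_def[symmetric] y_def[symmetric]
      by (cases "w = z") (simp_all add: pos_divide_le_eq)
  qed
qed

lemma num_reductions_le:
  assumes "search_ends Z F \<theta> z (\<rho> ^ m * \<eta>)"
  obtains j where "num_reductions Z F \<theta> \<rho> z \<eta> = enat j" "j \<le> m"
    "search_ends Z F \<theta> z (\<rho> ^ j * \<eta>)"
proof -
  let ?P = "\<lambda>j. search_ends Z F \<theta> z (\<rho> ^ j * \<eta>)"
  have "num_reductions Z F \<theta> \<rho> z \<eta> = enat (LEAST j. ?P j)"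
    using assms unfolding num_reductions_def by auto
  then show thesis
    using that LeastI[of ?P, OF assms] Least_le[of ?P, OF assms] by blast
qed

text \<open>The same \<open>n\<close> counts the reductions so far and is the exponent of the
  current stepsize, so \<open>N\<close> acts as a budget for the whole run. Once the run has ended,
  the clause on the state is vacuous and only the count remains.\<close>

lemma pf_ne_eg_invariant:
  fixes Z :: "'a::euclidean_space set"
  assumes Z: "closed Z" "convex Z" and mono: "monotone_operator_on Z F"
    and sol: "vi_solution Z F zs" and \<eta>0: "\<eta>0 > 0" and \<theta>: "\<theta> \<le> 1" and \<rho>: "0 < \<rho>" "\<rho> \<le> 1"
    and R: "norm (eg_next Z F z0 \<eta>0 - zs) \<le> R"
    and ends: "\<And>z \<eta>. z \<in> Z \<Longrightarrow> norm (z - zs) \<le> R \<Longrightarrow> 0 < \<eta> \<Longrightarrow> \<eta> \<le> \<rho> ^ N * \<eta>0 \<Longrightarrow>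
      search_ends Z F \<theta> z \<eta>"
  shows "\<exists>n\<le>N. (\<Sum>s\<le>t. reductions_at Z F \<theta> \<rho> z0 \<eta>0 s) = enat n \<and>
    (\<forall>z \<eta>. pf_ne_eg Z F \<theta> \<rho> z0 \<eta>0 t = Some (z, \<eta>) \<longrightarrow>
      z \<in> Z \<and> norm (z - zs) \<le> R \<and> \<eta> = \<rho> ^ n * \<eta>0)"
proof (induction t)
  case 0
  have "Z \<noteq> {}" using sol by (auto simp: vi_solution_def)
  then show ?case
    using R eg_in_set(2)[OF Z(1)]
    by (intro exI[of _ 0]) (auto simp: reductions_at_def zero_enat_def)
next
  case (Suc t)
  then obtain n where n: "n \<le> N" "(\<Sum>s\<le>t. reductions_at Z F \<theta> \<rho> z0 \<eta>0 s) = enat n"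
    and inv: "\<And>z \<eta>. pf_ne_eg Z F \<theta> \<rho> z0 \<eta>0 t = Some (z, \<eta>) \<Longrightarrow>
      z \<in> Z \<and> norm (z - zs) \<le> R \<and> \<eta> = \<rho> ^ n * \<eta>0"
    by blast
  show ?case
  proof (cases "pf_ne_eg Z F \<theta> \<rho> z0 \<eta>0 t")
    case None
    then show ?thesis using n by (intro exI[of _ n]) (simp add: reductions_at_def)
  next
    case (Some p)
    then obtain z \<eta> where st: "pf_ne_eg Z F \<theta> \<rho> z0 \<eta>0 t = Some (z, \<eta>)" by (cases p) auto
    then have z: "z \<in> Z" "norm (z - zs) \<le> R" and \<eta>: "\<eta> = \<rho> ^ n * \<eta>0" using inv by auto
    \<comment> \<open>Spending the remaining budget \<open>N - n\<close> would bring the trial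
      stepsize down to the threshold, so the search ends no later than that.\<close>
    have "\<rho> ^ (N - n) * \<eta> = \<rho> ^ N * \<eta>0"
      using n(1) by (simp add: \<eta> power_add[symmetric] mult.assoc[symmetric])
    then have "search_ends Z F \<theta> z (\<rho> ^ (N - n) * \<eta>)"
      using ends[OF z] \<eta>0 \<rho> by simp
    then obtain j where j: "num_reductions Z F \<theta> \<rho> z \<eta> = enat j" "j \<le> N - n"
      "search_ends Z F \<theta> z (\<rho> ^ j * \<eta>)" by (rule num_reductions_le)
    \<comment> \<open>This holds even if the search ends by stopping: its reductions count although
      no new state is produced.\<close>
    have sum: "(\<Sum>s\<le>Suc t. reductions_at Z F \<theta> \<rho> z0 \<eta>0 s) = enat (n + j)"
      using n(2) j(1) st by (simp add: reductions_at_def)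
    \<comment> \<open>A new state exists only if the search did not stop at \<open>z\<close>, so its
      last trial was accepted and the nonexpansive estimate applies.\<close>
    have "z' \<in> Z \<and> norm (z' - zs) \<le> R \<and> \<eta>' = \<rho> ^ (n + j) * \<eta>0"
      if "pf_ne_eg Z F \<theta> \<rho> z0 \<eta>0 (Suc t) = Some (z', \<eta>')" for z' \<eta>'
    proof -
      have ne: "eg_w Z F z (\<rho> ^ j * \<eta>) \<noteq> z" and \<eta>': "\<eta>' = \<rho> ^ j * \<eta>"
        and z': "z' = eg_next Z F z \<eta>'"
        using that st j(1) by (auto simp: line_search_def split: if_splits)
      have "\<eta>' > 0" using \<eta>' \<eta> \<eta>0 \<rho> by simp
      moreover have "step_accepted Z F \<theta> z \<eta>'"
        using j(3) ne by (simp add: search_ends_def \<eta>')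
      ultimately have "norm (z' - zs) \<le> norm (z - zs)"
        unfolding z' using ne \<eta>' by (intro eg_next_nonexpansive[OF Z mono sol z(1) _ \<theta>]) auto
      then show ?thesis
        using z z' \<eta>' \<eta> eg_in_set(2)[OF Z(1)] by (auto simp: power_add mult_ac)
    qed
    then show ?thesis using sum n(1) j(2) by (intro exI[of _ "n + j"]) auto
  qed
qed

theorem lemma10:
  fixes Z :: "(real ^ 'd) set" and F :: "real ^ 'd \<Rightarrow> real ^ 'd"
    and z0 :: "real ^ 'd" and \<eta>0 \<theta> \<rho> :: real
  assumes "Z \<noteq> {}" and "closed Z" and "convex Z"
    and "monotone_operator_on Z F"
    and "locally_lipschitz_on Z F"
    and "\<exists>zs. vi_solution Z F zs"
    and "z0 \<in> Z" and "\<eta>0 > 0"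
    and "\<theta> \<in> {0<..<1}" and "\<rho> \<in> {0<..<1}"
  shows "(\<Sum>t. reductions_at Z F \<theta> \<rho> z0 \<eta>0 t) < \<infinity> \<and>
    (\<exists>\<eta>bar>0. \<forall>t \<eta>. stepsize Z F \<theta> \<rho> z0 \<eta>0 t = Some \<eta> \<longrightarrow> \<eta> \<ge> \<eta>bar)"
proof -
  obtain zs where sol: "vi_solution Z F zs" using assms by blast
  have \<theta>: "0 < \<theta>" "\<theta> \<le> 1" and \<rho>: "0 < \<rho>" "\<rho> \<le> 1" "\<rho> < 1" using assms by auto
  \<comment> \<open>The radius is taken from the iterate after iteration 0: that step uses
    \<open>\<eta>0\<close> without any acceptance test and may move away from the solution.\<close>
  define R where "R = norm (eg_next Z F z0 \<eta>0 - zs)"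
  obtain c where c: "c > 0"
    "\<And>z \<eta>. z \<in> Z \<Longrightarrow> norm (z - zs) \<le> R \<Longrightarrow> 0 < \<eta> \<Longrightarrow> \<eta> \<le> c \<Longrightarrow> search_ends Z F \<theta> z \<eta>"
    using search_ends_below_threshold[OF assms(2,3,1,5) \<theta>, of zs R] by metis
  obtain N where "\<rho> ^ N < c / \<eta>0"
    using real_arch_pow_inv[of "c / \<eta>0" \<rho>] c(1) \<open>\<eta>0 > 0\<close> \<rho> by auto
  then have N: "\<rho> ^ N * \<eta>0 \<le> c" using \<open>\<eta>0 > 0\<close> by (simp add: pos_less_divide_eq)
  have inv: "\<exists>n\<le>N. (\<Sum>s\<le>t. reductions_at Z F \<theta> \<rho> z0 \<eta>0 s) = enat n \<and>
    (\<forall>z \<eta>. pf_ne_eg Z F \<theta> \<rho> z0 \<eta>0 t = Some (z, \<eta>) \<longrightarrow>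
      z \<in> Z \<and> norm (z - zs) \<le> R \<and> \<eta> = \<rho> ^ n * \<eta>0)" for t
    by (rule pf_ne_eg_invariant[OF assms(2-4) sol \<open>\<eta>0 > 0\<close> \<theta>(2) \<rho>(1,2)])
      (use c(2) N R_def in auto)
  \<comment> \<open>Series in \<open>enat\<close> always converge, so a uniform bound on the partial
    sums bounds the total.\<close>
  have "(\<Sum>s<t. reductions_at Z F \<theta> \<rho> z0 \<eta>0 s) \<le> enat N" for t
  proof (cases t)
    case (Suc s)
    then show ?thesis using inv[of s] by (auto simp: lessThan_Suc_atMost)
  qed simp
  then have "(\<Sum>t. reductions_at Z F \<theta> \<rho> z0 \<eta>0 t) \<le> enat N"
    by (intro suminf_le_const summableI)
  then have "(\<Sum>t. reductions_at Z F \<theta> \<rho> z0 \<eta>0 t) < \<infinity>"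
    using enat_ord_simps(4) le_less_trans by blast
  moreover have "\<eta> \<ge> \<rho> ^ N * \<eta>0" if "stepsize Z F \<theta> \<rho> z0 \<eta>0 t = Some \<eta>" for t \<eta>
  proof -
    \<comment> \<open>Index 0 is separate: \<open>stepsize\<close> returns \<open>\<eta>0\<close>
      there even when the algorithm stops at once and there is no state to consult.\<close>
    obtain n where "n \<le> N" "\<eta> = \<rho> ^ n * \<eta>0"
    proof (cases "t = 0")
      case True
      then show ?thesis using that[of 0] \<open>stepsize _ _ _ _ _ _ _ = _\<close> by (simp add: stepsize_def)
    next
      case False
      then obtain z where "pf_ne_eg Z F \<theta> \<rho> z0 \<eta>0 t = Some (z, \<eta>)"
        using \<open>stepsize _ _ _ _ _ _ _ = _\<close> by (auto simp: stepsize_def)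
      then show ?thesis using inv[of t] that by blast
    qed
    then show ?thesis using \<rho> \<open>\<eta>0 > 0\<close> by (simp add: power_decreasing mult_right_mono)
  qed
  moreover have "\<rho> ^ N * \<eta>0 > 0" using \<rho> \<open>\<eta>0 > 0\<close> by simp
  ultimately show ?thesis by blast
qed

end
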